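(* Let $\underline R$ be a square ring and let $M$ be an $\underline R$-BHP-module. Then the $\mathbb N^*$-graded abelian groups $$\mathrm{Gr}_\gamma(M)=(M/[M,M]_{\underline R},\ [M,M]_{\underline R},\ 0,\ldots)\quad\text{and}\quad \mathrm{Gr}_{\mathsf Z}(M)=(M/\mathsf Z_{\underline R}(M),\ \mathsf Z_{\underline R}(M),\ 0,\ldots)$$ have a natural structure of graded algebra over the operad $\mathrm{OP}(\underline R)$.
   Context: A square ring $\underline R=(R_e\xrightarrow{H}R_{ee}\xrightarrow{P}R_e)$ consists of: a set $R_e$ with a group structure $+$ (not necessarily commutative) and an associative unital multiplication satisfying $r(s+t)=rs+rt$ (the law $(r+s)t=rt+st$ is not required); an abelian group $R_{ee}$; a map $R_e\times R_e\times R_{ee}\times R_e\to R_{ee}$, $(r,s,x,t)\mapsto(r,s)\cdot x\cdot t$, additive in each of its four variables and defining commuting actions on $R_{ee}$ of the multiplicative monoids $R_e\times R_e$ (on the left) and $R_e$ (on the right) (write $(r,s)\cdot x$ if $t=1$ and $x\cdot t$ if $r=s=1$); a group homomorphism $T:R_{ee}\to R_{ee}$ with $T^2=\mathrm{Id}$; a map $H:R_e\to R_{ee}$ and a group homomorphism $P:R_{ee}\to R_e$; such that for all $r,s,t\in R_e$, $x,y\in R_{ee}$: $PHP=P+P$; $P((r,r)\cdot x\cdot s)=rP(x)s$; $T=HP-\mathrm{Id}$; $PT=P$; $(P(x),r)\cdot y=(r,P(x))\cdot y=0=y\cdot P(x)$; $H(r+s)=H(r)+H(s)+(s,r)\cdot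 H(2)$ where $2=1+1$; $H(rs)=(r,r)\cdot H(s)+H(r)\cdot s$; $(r+s)t=rt+st+P((r,s)\cdot H(t))$; $T((r,s)\cdot x\cdot t)=(s,r)\cdot T(x)\cdot t$. The quotient $\overline R=R_e/\operatorname{Im}P$ is a ring and $R_{ee}$ is an $\overline R\otimes\overline R\otimes\overline R^{op}$-module. $\mathrm{OP}(\underline R)$ is the operad of abelian groups, nilpotent of class $\le2$, with $\mathrm{OP}(\underline R)_1=\overline R$, $\mathrm{OP}(\underline R)_2=R_{ee}$ (symmetric group action given by $T$), $\mathrm{OP}(\underline R)_k=0$ for $k>2$, and compositions given by the multiplication of $\overline R$ and its actions on $R_{ee}$. Concretely, a graded $\mathrm{OP}(\underline R)$-algebra structure on a graded abelian group $X=(X_1,X_2,0,\ldots)$ consists of right $\overline R$-module structures on $X_1,X_2$ and maps $X_i\times X_j\times R_{ee}\to X_{i+j}$, $(u,v,x)\mapsto[u,v]\cdot x$, additive in each variable, with $[v,u]\cdot x=[u,v]\cdot T(x)$, $([u\cdot r,v\cdot s]\cdot x)\cdot t=[u,v]\cdot((r,s)\cdot x\cdot t)$ for $r,s,t\in\overline R$, and vanishing iterated operations $[[u,v]\cdot x,w]\cdot y=0$. A (right) $\underline R$-BHP-module is a group $M$ (written additively, not necessarily commutative) with operations $M\times R_e\to M$, $(m,r)\mapsto m\cdot r$ and $M\times M\times R_{ee}\to M$, $(m,n,x)\mapsto[m,n]\cdot x$ such that: $m\cdot1=m$, $(m\cdot r)\cdot s=m\cdot(rs)$, $m\cdot(r+s)=m\cdot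 r+m\cdot s$; $(m+n)\cdot r=m\cdot r+n\cdot r+[m,n]\cdot H(r)$; $m\cdot P(x)=[m,m]\cdot x$; $[m,n]\cdot T(x)=[n,m]\cdot x$; $[m,n]\cdot x$ is additive in each of $m,n,x$; $([m\cdot r,n\cdot s]\cdot x)\cdot t=[m,n]\cdot((r,s)\cdot x\cdot t)$; $[[m,m']\cdot x,n]\cdot y=0$. A BHP-submodule is a subgroup stable under the operations of $R_e$ and $R_{ee}$. $[M,M]_{\underline R}$ is the BHP-submodule generated by all $[m,n]\cdot x$ ($m,n\in M$, $x\in R_{ee}$), and $\mathsf Z_{\underline R}(M)=\{m\in M:[m,n]\cdot x=0\ \text{for all }n\in M,x\in R_{ee}\}$. The natural structures meant are those induced by the operations of $M$: for $A=[M,M]_{\underline R}$, resp. $A=\mathsf Z_{\underline R}(M)$, $(\overline m,a)\cdot\overline r=(\overline{m\cdot r},a\cdot r)$ on $M/A\oplus A$, and $\overline m\otimes\overline{m'}\otimes x\mapsto[m,m']\cdot x$ from $(M/A)\otimes(M/A)\otimes R_{ee}$ to $A$ (all other binary operations being zero for degree reasons). *)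

theory Defs
  imports "HOL-Algebra.QuotRing"
begin

text \<open>
  The group laws of \<open>R\<^sub>e\<close> (commutative or not), of \<open>R\<^sub>e\<^sub>e\<close>, of a BHP-module \<open>M\<close> and of the graded
  pieces are all written \<open>+\<close> on paper. Here \<open>R\<^sub>e\<close> is a ring record \<open>R\<close>, so its two operations are
  \<open>\<oplus>\<close> and \<open>\<otimes>\<close>, whereas the other three are plain group records whose group law is
  \<open>\<otimes>\<^bsub>E\<^esub>\<close>, \<open>\<otimes>\<^bsub>M\<^esub>\<close>, \<open>\<otimes>\<^bsub>X k\<^esub>\<close> and whose neutral element (\<open>0\<close> on paper) is \<open>\<one>\<^bsub>E\<^esub>\<close>, \<open>\<one>\<^bsub>M\<^esub>\<close>, \<open>\<one>\<^bsub>X k\<^esub>\<close>.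
\<close>

section \<open>Square rings\<close>

text \<open>
  \<open>act r s x t\<close> is \<open>(r,s)\<cdot>x\<cdot>t\<close>. The laws \<open>act_one\<close> and \<open>act_mult\<close> say exactly that \<open>act r s x \<one>\<close>
  and \<open>act \<one> \<one> x t\<close> are a left action of the monoid \<open>R\<^sub>e \<times> R\<^sub>e\<close> and a right action of \<open>R\<^sub>e\<close>, that
  the two commute, and that \<open>act\<close> is their composite.
\<close>

locale square_ring =
  fixes R :: "'r ring" (structure)
    and E :: "'e monoid"
    and act :: "'r \<Rightarrow> 'r \<Rightarrow> 'e \<Rightarrow> 'r \<Rightarrow> 'e"
    and T :: "'e \<Rightarrow> 'e"
    and H :: "'r \<Rightarrow> 'e"
    and P :: "'e \<Rightarrow> 'r"
  assumes group_R: "group (add_monoid R)"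
    and monoid_R: "monoid R"
    and r_distr_R: "\<lbrakk>r \<in> carrier R; s \<in> carrier R; t \<in> carrier R\<rbrakk>
      \<Longrightarrow> r \<otimes> (s \<oplus> t) = r \<otimes> s \<oplus> r \<otimes> t"
    and comm_group_E: "comm_group E"
    and act_closed: "\<lbrakk>r \<in> carrier R; s \<in> carrier R; x \<in> carrier E; t \<in> carrier R\<rbrakk>
      \<Longrightarrow> act r s x t \<in> carrier E"
    and act_add1: "\<lbrakk>r \<in> carrier R; r' \<in> carrier R; s \<in> carrier R; x \<in> carrier E; t \<in> carrier R\<rbrakk>
      \<Longrightarrow> act (r \<oplus> r') s x t = act r s x t \<otimes>\<^bsub>E\<^esub> act r' s x t"
    and act_add2: "\<lbrakk>r \<in> carrier R; s \<in> carrier R; s' \<in> carrier R; x \<in> carrier E; t \<in> carrier R\<rbrakk>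
      \<Longrightarrow> act r (s \<oplus> s') x t = act r s x t \<otimes>\<^bsub>E\<^esub> act r s' x t"
    and act_add3: "\<lbrakk>r \<in> carrier R; s \<in> carrier R; x \<in> carrier E; x' \<in> carrier E; t \<in> carrier R\<rbrakk>
      \<Longrightarrow> act r s (x \<otimes>\<^bsub>E\<^esub> x') t = act r s x t \<otimes>\<^bsub>E\<^esub> act r s x' t"
    and act_add4: "\<lbrakk>r \<in> carrier R; s \<in> carrier R; x \<in> carrier E; t \<in> carrier R; t' \<in> carrier R\<rbrakk>
      \<Longrightarrow> act r s x (t \<oplus> t') = act r s x t \<otimes>\<^bsub>E\<^esub> act r s x t'"
    and act_one: "x \<in> carrier E \<Longrightarrow> act \<one> \<one> x \<one> = x"
    and act_mult: "\<lbrakk>r \<in> carrier R; r' \<in> carrier R; s \<in> carrier R; s' \<in> carrier R; x \<in> carrier E;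
        t \<in> carrier R; t' \<in> carrier R\<rbrakk>
      \<Longrightarrow> act (r \<otimes> r') (s \<otimes> s') x (t \<otimes> t') = act r s (act r' s' x t) t'"
    and T_hom: "T \<in> hom E E"
    and T_T: "x \<in> carrier E \<Longrightarrow> T (T x) = x"
    and H_closed: "H \<in> carrier R \<rightarrow> carrier E"
    and P_hom: "P \<in> hom E (add_monoid R)"
    and P_H_P: "x \<in> carrier E \<Longrightarrow> P (H (P x)) = P x \<oplus> P x"
    and P_act: "\<lbrakk>r \<in> carrier R; x \<in> carrier E; s \<in> carrier R\<rbrakk> \<Longrightarrow> P (act r r x s) = r \<otimes> P x \<otimes> s"
    and T_eq: "x \<in> carrier E \<Longrightarrow> T x = H (P x) \<otimes>\<^bsub>E\<^esub> inv\<^bsub>E\<^esub> x"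
    and P_T: "x \<in> carrier E \<Longrightarrow> P (T x) = P x"
    and act_P1: "\<lbrakk>x \<in> carrier E; r \<in> carrier R; y \<in> carrier E\<rbrakk> \<Longrightarrow> act (P x) r y \<one> = \<one>\<^bsub>E\<^esub>"
    and act_P2: "\<lbrakk>x \<in> carrier E; r \<in> carrier R; y \<in> carrier E\<rbrakk> \<Longrightarrow> act r (P x) y \<one> = \<one>\<^bsub>E\<^esub>"
    and act_P3: "\<lbrakk>x \<in> carrier E; y \<in> carrier E\<rbrakk> \<Longrightarrow> act \<one> \<one> y (P x) = \<one>\<^bsub>E\<^esub>"
    and H_add: "\<lbrakk>r \<in> carrier R; s \<in> carrier R\<rbrakk>
      \<Longrightarrow> H (r \<oplus> s) = H r \<otimes>\<^bsub>E\<^esub> H s \<otimes>\<^bsub>E\<^esub> act s r (H (\<one> \<oplus> \<one>)) \<one>"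
    and H_mult: "\<lbrakk>r \<in> carrier R; s \<in> carrier R\<rbrakk>
      \<Longrightarrow> H (r \<otimes> s) = act r r (H s) \<one> \<otimes>\<^bsub>E\<^esub> act \<one> \<one> (H r) s"
    and l_distr_R: "\<lbrakk>r \<in> carrier R; s \<in> carrier R; t \<in> carrier R\<rbrakk>
      \<Longrightarrow> (r \<oplus> s) \<otimes> t = r \<otimes> t \<oplus> s \<otimes> t \<oplus> P (act r s (H t) \<one>)"
    and T_act: "\<lbrakk>r \<in> carrier R; s \<in> carrier R; x \<in> carrier E; t \<in> carrier R\<rbrakk>
      \<Longrightarrow> T (act r s x t) = act s r (T x) t"


section \<open>BHP-modules\<close>

text \<open>\<open>ract m r\<close> is \<open>m\<cdot>r\<close>, and \<open>brk m n x\<close> is \<open>[m,n]\<cdot>x\<close>.\<close>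

locale bhp_module = square_ring R E act T H P
  for R :: "'r ring" (structure) and E :: "'e monoid" and act T H P +
  fixes M :: "'m monoid"
    and ract :: "'m \<Rightarrow> 'r \<Rightarrow> 'm"
    and brk :: "'m \<Rightarrow> 'm \<Rightarrow> 'e \<Rightarrow> 'm"
  assumes group_M: "group M"
    and ract_closed: "\<lbrakk>m \<in> carrier M; r \<in> carrier R\<rbrakk> \<Longrightarrow> ract m r \<in> carrier M"
    and brk_closed: "\<lbrakk>m \<in> carrier M; n \<in> carrier M; x \<in> carrier E\<rbrakk> \<Longrightarrow> brk m n x \<in> carrier M"
    and ract_one: "m \<in> carrier M \<Longrightarrow> ract m \<one> = m"
    and ract_mult: "\<lbrakk>m \<in> carrier M; r \<in> carrier R; s \<in> carrier R\<rbrakk>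
      \<Longrightarrow> ract (ract m r) s = ract m (r \<otimes> s)"
    and ract_add: "\<lbrakk>m \<in> carrier M; r \<in> carrier R; s \<in> carrier R\<rbrakk>
      \<Longrightarrow> ract m (r \<oplus> s) = ract m r \<otimes>\<^bsub>M\<^esub> ract m s"
    and add_ract: "\<lbrakk>m \<in> carrier M; n \<in> carrier M; r \<in> carrier R\<rbrakk>
      \<Longrightarrow> ract (m \<otimes>\<^bsub>M\<^esub> n) r = ract m r \<otimes>\<^bsub>M\<^esub> ract n r \<otimes>\<^bsub>M\<^esub> brk m n (H r)"
    and ract_P: "\<lbrakk>m \<in> carrier M; x \<in> carrier E\<rbrakk> \<Longrightarrow> ract m (P x) = brk m m x"
    and brk_T: "\<lbrakk>m \<in> carrier M; n \<in> carrier M; x \<in> carrier E\<rbrakk> \<Longrightarrow> brk m n (T x) = brk n m x"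
    and brk_add1: "\<lbrakk>m \<in> carrier M; m' \<in> carrier M; n \<in> carrier M; x \<in> carrier E\<rbrakk>
      \<Longrightarrow> brk (m \<otimes>\<^bsub>M\<^esub> m') n x = brk m n x \<otimes>\<^bsub>M\<^esub> brk m' n x"
    and brk_add2: "\<lbrakk>m \<in> carrier M; n \<in> carrier M; n' \<in> carrier M; x \<in> carrier E\<rbrakk>
      \<Longrightarrow> brk m (n \<otimes>\<^bsub>M\<^esub> n') x = brk m n x \<otimes>\<^bsub>M\<^esub> brk m n' x"
    and brk_add3: "\<lbrakk>m \<in> carrier M; n \<in> carrier M; x \<in> carrier E; x' \<in> carrier E\<rbrakk>
      \<Longrightarrow> brk m n (x \<otimes>\<^bsub>E\<^esub> x') = brk m n x \<otimes>\<^bsub>M\<^esub> brk m n x'"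
    and brk_ract: "\<lbrakk>m \<in> carrier M; n \<in> carrier M; r \<in> carrier R; s \<in> carrier R; x \<in> carrier E;
        t \<in> carrier R\<rbrakk>
      \<Longrightarrow> ract (brk (ract m r) (ract n s) x) t = brk m n (act r s x t)"
    and brk_brk: "\<lbrakk>m \<in> carrier M; m' \<in> carrier M; n \<in> carrier M; x \<in> carrier E; y \<in> carrier E\<rbrakk>
      \<Longrightarrow> brk (brk m m' x) n y = \<one>\<^bsub>M\<^esub>"

definition bhp_submodule ::
    "'r ring \<Rightarrow> 'e monoid \<Rightarrow> 'm monoid \<Rightarrow> ('m \<Rightarrow> 'r \<Rightarrow> 'm) \<Rightarrow> ('m \<Rightarrow> 'm \<Rightarrow> 'e \<Rightarrow> 'm) \<Rightarrow> 'm set \<Rightarrow> bool"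
  where "bhp_submodule R E M ract brk N \<longleftrightarrow>
    subgroup N M \<and>
    (\<forall>a\<in>N. \<forall>r\<in>carrier R. ract a r \<in> N) \<and>
    (\<forall>a\<in>N. \<forall>b\<in>N. \<forall>x\<in>carrier E. brk a b x \<in> N)"

definition bhp_generate ::
    "'r ring \<Rightarrow> 'e monoid \<Rightarrow> 'm monoid \<Rightarrow> ('m \<Rightarrow> 'r \<Rightarrow> 'm) \<Rightarrow> ('m \<Rightarrow> 'm \<Rightarrow> 'e \<Rightarrow> 'm) \<Rightarrow> 'm set \<Rightarrow> 'm set"
  where "bhp_generate R E M ract brk S = \<Inter>{N. bhp_submodule R E M ract brk N \<and> S \<subseteq> N}"

definition bhp_derived ::
    "'r ring \<Rightarrow> 'e monoid \<Rightarrow> 'm monoid \<Rightarrow> ('m \<Rightarrow> 'r \<Rightarrow> 'm) \<Rightarrow> ('m \<Rightarrow> 'm \<Rightarrow> 'e \<Rightarrow> 'm) \<Rightarrow> 'm set"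
  where "bhp_derived R E M ract brk =
    bhp_generate R E M ract brk
      {brk m n x | m n x. m \<in> carrier M \<and> n \<in> carrier M \<and> x \<in> carrier E}"

definition bhp_center :: "'e monoid \<Rightarrow> 'm monoid \<Rightarrow> ('m \<Rightarrow> 'm \<Rightarrow> 'e \<Rightarrow> 'm) \<Rightarrow> 'm set"
  where "bhp_center E M brk =
    {m \<in> carrier M. \<forall>n\<in>carrier M. \<forall>x\<in>carrier E. brk m n x = \<one>\<^bsub>M\<^esub>}"


section \<open>Operads of nilpotency class at most two and their graded algebras\<close>

text \<open>
  An operad \<open>Op\<close> of abelian groups with \<open>Op\<^sub>k = 0\<close> for \<open>k > 2\<close> (and no nullary operations) is
  given by the ring \<open>Op\<^sub>1\<close>, the abelian group \<open>Op\<^sub>2\<close> with its involution \<open>op_sym\<close> (the action of the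
  symmetric group on two letters), and the compositions of operations of \<open>Op\<^sub>2\<close> with operations of
  \<open>Op\<^sub>1\<close>. These compositions are recorded in \<open>op_comp r s x t\<close>, where \<open>r\<close> and \<open>s\<close> are plugged into
  the two inputs of \<open>x\<close>, and \<open>t\<close> is applied to its output. As algebras are right modules over
  \<open>Op\<^sub>1\<close>, the element \<open>t\<close> acts on the right.
\<close>

record ('s, 'e) operad2 =
  op_unary :: "'s ring"
  op_binary :: "'e monoid"
  op_sym :: "'e \<Rightarrow> 'e"
  op_comp :: "'s \<Rightarrow> 's \<Rightarrow> 'e \<Rightarrow> 's \<Rightarrow> 'e"

locale nil2_operad =
  fixes Op :: "('s, 'e) operad2"
    and S :: "'s ring" (structure)
    and E :: "'e monoid"
  defines "S \<equiv> op_unary Op"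
    and "E \<equiv> op_binary Op"
  assumes ring_unary: "ring S"
    and comm_group_binary: "comm_group E"
    and sym_hom: "op_sym Op \<in> hom E E"
    and sym_sym: "x \<in> carrier E \<Longrightarrow> op_sym Op (op_sym Op x) = x"
    and comp_closed: "\<lbrakk>r \<in> carrier S; s \<in> carrier S; x \<in> carrier E; t \<in> carrier S\<rbrakk>
      \<Longrightarrow> op_comp Op r s x t \<in> carrier E"
    and comp_add1: "\<lbrakk>r \<in> carrier S; r' \<in> carrier S; s \<in> carrier S; x \<in> carrier E; t \<in> carrier S\<rbrakk>
      \<Longrightarrow> op_comp Op (r \<oplus> r') s x t = op_comp Op r s x t \<otimes>\<^bsub>E\<^esub> op_comp Op r' s x t"
    and comp_add2: "\<lbrakk>r \<in> carrier S; s \<in> carrier S; s' \<in> carrier S; x \<in> carrier E; t \<in> carrier S\<rbrakk>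
      \<Longrightarrow> op_comp Op r (s \<oplus> s') x t = op_comp Op r s x t \<otimes>\<^bsub>E\<^esub> op_comp Op r s' x t"
    and comp_add3: "\<lbrakk>r \<in> carrier S; s \<in> carrier S; x \<in> carrier E; x' \<in> carrier E; t \<in> carrier S\<rbrakk>
      \<Longrightarrow> op_comp Op r s (x \<otimes>\<^bsub>E\<^esub> x') t = op_comp Op r s x t \<otimes>\<^bsub>E\<^esub> op_comp Op r s x' t"
    and comp_add4: "\<lbrakk>r \<in> carrier S; s \<in> carrier S; x \<in> carrier E; t \<in> carrier S; t' \<in> carrier S\<rbrakk>
      \<Longrightarrow> op_comp Op r s x (t \<oplus> t') = op_comp Op r s x t \<otimes>\<^bsub>E\<^esub> op_comp Op r s x t'"
    and comp_one: "x \<in> carrier E \<Longrightarrow> op_comp Op \<one> \<one> x \<one> = x"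
    and comp_mult: "\<lbrakk>r \<in> carrier S; r' \<in> carrier S; s \<in> carrier S; s' \<in> carrier S; x \<in> carrier E;
        t \<in> carrier S; t' \<in> carrier S\<rbrakk>
      \<Longrightarrow> op_comp Op (r \<otimes> r') (s \<otimes> s') x (t \<otimes> t') = op_comp Op r s (op_comp Op r' s' x t) t'"
    and comp_sym: "\<lbrakk>r \<in> carrier S; s \<in> carrier S; x \<in> carrier E; t \<in> carrier S\<rbrakk>
      \<Longrightarrow> op_sym Op (op_comp Op r s x t) = op_comp Op s r (op_sym Op x) t"

text \<open>
  The operad \<open>OP(R)\<close>. Its unary part is the quotient \<open>R\<^sub>e / Im P\<close>; the elements of the latter are
  cosets, which act on \<open>R\<^sub>e\<^sub>e\<close> through arbitrary representatives: see \<open>OP_comp_coset\<close> below.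
\<close>

definition OP ::
    "'r ring \<Rightarrow> 'e monoid \<Rightarrow> ('r \<Rightarrow> 'r \<Rightarrow> 'e \<Rightarrow> 'r \<Rightarrow> 'e) \<Rightarrow> ('e \<Rightarrow> 'e) \<Rightarrow> ('e \<Rightarrow> 'r)
      \<Rightarrow> ('r set, 'e) operad2"
  where "OP R E act T P =
    \<lparr>op_unary = R Quot (P ` carrier E),
     op_binary = E,
     op_sym = T,
     op_comp = (\<lambda>A B x C. the_elem ((\<lambda>(a, b, c). act a b x c) ` (A \<times> B \<times> C)))\<rparr>"

lemma (in square_ring) OP_comp_coset:
  assumes r: "r \<in> carrier R" and s: "s \<in> carrier R" and x: "x \<in> carrier E" and t: "t \<in> carrier R"
  shows "op_comp (OP R E act T P)
      (P ` carrier E +> r) (P ` carrier E +> s) x (P ` carrier E +> t) = act r s x t"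
proof -
  interpret E: comm_group E by (rule comm_group_E)
  interpret R: monoid R by (rule monoid_R)
  interpret G: group "add_monoid R" by (rule group_R)
  have PC: "P z \<in> carrier R" if "z \<in> carrier E" for z
    using hom_in_carrier[OF P_hom that] by simp
  have addC: "a \<oplus> b \<in> carrier R" if "a \<in> carrier R" "b \<in> carrier R" for a b
    using G.m_closed that by simp
  have zero: "act a b \<one>\<^bsub>E\<^esub> c = \<one>\<^bsub>E\<^esub>"
    if "a \<in> carrier R" "b \<in> carrier R" "c \<in> carrier R" for a b c
    using act_add3[of a b "\<one>\<^bsub>E\<^esub>" "\<one>\<^bsub>E\<^esub>" c] act_closed[of a b "\<one>\<^bsub>E\<^esub>" c] that
    by (simp add: E.l_cancel_one')
  have P1: "act (P z) b x c = \<one>\<^bsub>E\<^esub>"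
    if "z \<in> carrier E" "b \<in> carrier R" "c \<in> carrier R" for z b c
  proof -
    have "act (P z) b x c = act (\<one> \<otimes> P z) (\<one> \<otimes> b) x (\<one> \<otimes> c)"
      using that PC by simp
    also have "\<dots> = act \<one> \<one> (act (P z) b x \<one>) c"
      using that PC x by (intro act_mult) simp_all
    also have "\<dots> = \<one>\<^bsub>E\<^esub>"
      using that x by (simp only: act_P1 zero R.one_closed)
    finally show ?thesis .
  qed
  have P2: "act b (P z) x c = \<one>\<^bsub>E\<^esub>"
    if "z \<in> carrier E" "b \<in> carrier R" "c \<in> carrier R" for z b c
  proof -
    have "act b (P z) x c = act (\<one> \<otimes> b) (\<one> \<otimes> P z) x (\<one> \<otimes> c)"
      using that PC by simp
    also have "\<dots> = act \<one> \<one> (act b (P z) x \<one>) c"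
      using that PC x by (intro act_mult) simp_all
    also have "\<dots> = \<one>\<^bsub>E\<^esub>"
      using that x by (simp only: act_P2 zero R.one_closed)
    finally show ?thesis .
  qed
  have P3: "act b c x (P z) = \<one>\<^bsub>E\<^esub>"
    if "z \<in> carrier E" "b \<in> carrier R" "c \<in> carrier R" for z b c
  proof -
    have "act b c x (P z) = act (b \<otimes> \<one>) (c \<otimes> \<one>) x (P z \<otimes> \<one>)"
      using that PC by simp
    also have "\<dots> = act b c (act \<one> \<one> x (P z)) \<one>"
      using that PC x by (intro act_mult) simp_all
    also have "\<dots> = \<one>\<^bsub>E\<^esub>"
      using that x by (simp only: act_P3 zero R.one_closed)
    finally show ?thesis .
  qed
  have coset: "a \<in> P ` carrier E +> q \<longleftrightarrow> (\<exists>u\<in>carrier E. a = P u \<oplus> q)" for a q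
    by (auto simp: a_r_coset_def r_coset_def)
  have const: "act a b x c = act r s x t"
    if in_coset: "a \<in> P ` carrier E +> r" "b \<in> P ` carrier E +> s" "c \<in> P ` carrier E +> t" for a b c
  proof -
    obtain u v w where uvw: "u \<in> carrier E" "v \<in> carrier E" "w \<in> carrier E"
      and abc: "a = P u \<oplus> r" "b = P v \<oplus> s" "c = P w \<oplus> t"
      using in_coset unfolding coset by blast
    note C = r s t PC[OF uvw(1)] PC[OF uvw(2)] PC[OF uvw(3)]
    have "act a b x c = act r b x c"
      unfolding abc(1) using C x uvw
      by (subst act_add1) (simp_all add: abc addC P1 act_closed)
    also have "\<dots> = act r s x c"
      unfolding abc(2) using C x uvw
      by (subst act_add2) (simp_all add: abc addC P2 act_closed)
    also have "\<dots> = act r s x t"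
      unfolding abc(3) using C x uvw
      by (subst act_add4) (simp_all add: P3 act_closed)
    finally show ?thesis .
  qed
  have ne: "P ` carrier E +> q \<noteq> {}" for q
    using coset[of _ q] E.one_closed by blast
  let ?Z = "(P ` carrier E +> r) \<times> (P ` carrier E +> s) \<times> (P ` carrier E +> t)"
  have "(\<lambda>(a, b, c). act a b x c) ` ?Z = (\<lambda>_. act r s x t) ` ?Z"
    by (intro image_cong refl) (auto simp: const)
  also have "\<dots> = {act r s x t}"
    by (simp add: image_constant_conv ne)
  finally show ?thesis by (simp add: OP_def)
qed

locale right_module =
  fixes S :: "'s ring" (structure)
    and X :: "'x monoid"
    and ract :: "'x \<Rightarrow> 's \<Rightarrow> 'x"
  assumes ring_S: "ring S"
    and comm_group_X: "comm_group X"
    and ract_closed: "\<lbrakk>u \<in> carrier X; r \<in> carrier S\<rbrakk> \<Longrightarrow> ract u r \<in> carrier X"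
    and add_ract: "\<lbrakk>u \<in> carrier X; v \<in> carrier X; r \<in> carrier S\<rbrakk>
      \<Longrightarrow> ract (u \<otimes>\<^bsub>X\<^esub> v) r = ract u r \<otimes>\<^bsub>X\<^esub> ract v r"
    and ract_add: "\<lbrakk>u \<in> carrier X; r \<in> carrier S; s \<in> carrier S\<rbrakk>
      \<Longrightarrow> ract u (r \<oplus> s) = ract u r \<otimes>\<^bsub>X\<^esub> ract u s"
    and ract_one: "u \<in> carrier X \<Longrightarrow> ract u \<one> = u"
    and ract_mult: "\<lbrakk>u \<in> carrier X; r \<in> carrier S; s \<in> carrier S\<rbrakk>
      \<Longrightarrow> ract (ract u r) s = ract u (r \<otimes> s)"

text \<open>
  A grading by the positive integers is a sequence \<open>X 1, X 2, \<dots>\<close>; \<open>X 0\<close> is ignored.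
  \<open>ract k u r\<close> is \<open>u\<cdot>r\<close> for \<open>u\<close> of degree \<open>k\<close>, and \<open>brk i j u v x\<close> is \<open>[u,v]\<cdot>x\<close> for \<open>u\<close>, \<open>v\<close> of
  degrees \<open>i\<close>, \<open>j\<close>.
\<close>

locale graded_algebra = nil2_operad Op S E
  for Op :: "('s, 'e) operad2" and S :: "'s ring" (structure) and E :: "'e monoid" +
  fixes X :: "nat \<Rightarrow> 'x monoid"
    and ract :: "nat \<Rightarrow> 'x \<Rightarrow> 's \<Rightarrow> 'x"
    and brk :: "nat \<Rightarrow> nat \<Rightarrow> 'x \<Rightarrow> 'x \<Rightarrow> 'e \<Rightarrow> 'x"
  assumes right_module_X: "1 \<le> k \<Longrightarrow> right_module S (X k) (ract k)"
    and brk_closed: "\<lbrakk>1 \<le> i; 1 \<le> j; u \<in> carrier (X i); v \<in> carrier (X j); x \<in> carrier E\<rbrakk>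
      \<Longrightarrow> brk i j u v x \<in> carrier (X (i + j))"
    and brk_add1: "\<lbrakk>1 \<le> i; 1 \<le> j; u \<in> carrier (X i); u' \<in> carrier (X i); v \<in> carrier (X j);
        x \<in> carrier E\<rbrakk>
      \<Longrightarrow> brk i j (u \<otimes>\<^bsub>X i\<^esub> u') v x = brk i j u v x \<otimes>\<^bsub>X (i + j)\<^esub> brk i j u' v x"
    and brk_add2: "\<lbrakk>1 \<le> i; 1 \<le> j; u \<in> carrier (X i); v \<in> carrier (X j); v' \<in> carrier (X j);
        x \<in> carrier E\<rbrakk>
      \<Longrightarrow> brk i j u (v \<otimes>\<^bsub>X j\<^esub> v') x = brk i j u v x \<otimes>\<^bsub>X (i + j)\<^esub> brk i j u v' x"
    and brk_add3: "\<lbrakk>1 \<le> i; 1 \<le> j; u \<in> carrier (X i); v \<in> carrier (X j); x \<in> carrier E;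
        x' \<in> carrier E\<rbrakk>
      \<Longrightarrow> brk i j u v (x \<otimes>\<^bsub>E\<^esub> x') = brk i j u v x \<otimes>\<^bsub>X (i + j)\<^esub> brk i j u v x'"
    and brk_sym: "\<lbrakk>1 \<le> i; 1 \<le> j; u \<in> carrier (X i); v \<in> carrier (X j); x \<in> carrier E\<rbrakk>
      \<Longrightarrow> brk j i v u x = brk i j u v (op_sym Op x)"
    and brk_ract: "\<lbrakk>1 \<le> i; 1 \<le> j; u \<in> carrier (X i); v \<in> carrier (X j); r \<in> carrier S;
        s \<in> carrier S; x \<in> carrier E; t \<in> carrier S\<rbrakk>
      \<Longrightarrow> ract (i + j) (brk i j (ract i u r) (ract j v s) x) t
        = brk i j u v (op_comp Op r s x t)"
    and brk_brk: "\<lbrakk>1 \<le> i; 1 \<le> j; 1 \<le> k; u \<in> carrier (X i); v \<in> carrier (X j); w \<in> carrier (X k);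
        x \<in> carrier E; y \<in> carrier E\<rbrakk>
      \<Longrightarrow> brk (i + j) k (brk i j u v x) w y = \<one>\<^bsub>X (i + j + k)\<^esub>"


section \<open>The graded groups of a BHP-module\<close>

text \<open>
  The sequence \<open>(M/A, A, 0, \<dots>)\<close>. For all degrees to have the same element type, the pieces are the
  subgroups \<open>M/A \<times> 0\<close>, \<open>0 \<times> A\<close> and \<open>0 \<times> 0\<close> of \<open>M/A \<times> M\<close>; the zero element of \<open>M/A\<close> is the coset \<open>A\<close>.
\<close>

definition Gr :: "'m monoid \<Rightarrow> 'm set \<Rightarrow> nat \<Rightarrow> ('m set \<times> 'm) monoid"
  where "Gr M A k = ((M Mod A) \<times>\<times> M)
    \<lparr>carrier :=
      (if k = 1 then carrier (M Mod A) \<times> {\<one>\<^bsub>M\<^esub>}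
       else if k = 2 then {A} \<times> A
       else {(A, \<one>\<^bsub>M\<^esub>)})\<rparr>"

text \<open>
  The operations on \<open>Gr M A\<close> induced by those of \<open>M\<close>. All operations not mentioned take values in
  a zero group.
\<close>

definition induced_operations ::
    "'r ring \<Rightarrow> 'e monoid \<Rightarrow> ('e \<Rightarrow> 'r) \<Rightarrow> 'm monoid \<Rightarrow> ('m \<Rightarrow> 'r \<Rightarrow> 'm) \<Rightarrow> ('m \<Rightarrow> 'm \<Rightarrow> 'e \<Rightarrow> 'm)
      \<Rightarrow> 'm set \<Rightarrow> (nat \<Rightarrow> 'm set \<times> 'm \<Rightarrow> 'r set \<Rightarrow> 'm set \<times> 'm)
      \<Rightarrow> (nat \<Rightarrow> nat \<Rightarrow> 'm set \<times> 'm \<Rightarrow> 'm set \<times> 'm \<Rightarrow> 'e \<Rightarrow> 'm set \<times> 'm) \<Rightarrow> bool"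
  where "induced_operations R E P M ract brk A gract gbrk \<longleftrightarrow>
    (\<forall>m\<in>carrier M. \<forall>r\<in>carrier R.
      gract 1 (A #>\<^bsub>M\<^esub> m, \<one>\<^bsub>M\<^esub>) (P ` carrier E +>\<^bsub>R\<^esub> r) = (A #>\<^bsub>M\<^esub> ract m r, \<one>\<^bsub>M\<^esub>)) \<and>
    (\<forall>a\<in>A. \<forall>r\<in>carrier R.
      gract 2 (A, a) (P ` carrier E +>\<^bsub>R\<^esub> r) = (A, ract a r)) \<and>
    (\<forall>m\<in>carrier M. \<forall>m'\<in>carrier M. \<forall>x\<in>carrier E.
      gbrk 1 1 (A #>\<^bsub>M\<^esub> m, \<one>\<^bsub>M\<^esub>) (A #>\<^bsub>M\<^esub> m', \<one>\<^bsub>M\<^esub>) x = (A, brk m m' x))"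

end

theory Submission
  imports Defs
begin

text \<open>
  Evaluating \<open>(m + n)\<cdot>2\<close> by both distributive laws gives \<open>n + m = m + n + [m,n]\<cdot>H(2)\<close>. Hence \<open>Z(M)\<close> is
  contained in the centre of the group \<open>M\<close>, and commutators are brackets; likewise \<open>Im P\<close> is central
  in \<open>R\<^sub>e\<close> and contains its commutators. So if \<open>A \<subseteq> Z(M)\<close> is a BHP-submodule containing all brackets,
  then \<open>A\<close> and \<open>M/A\<close> are abelian, the defect \<open>[m,n]\<cdot>H(r)\<close> of additivity vanishes on both, and \<open>Im P\<close>
  acts trivially on both because \<open>m\<cdot>P(x) = [m,m]\<cdot>x\<close>. Both \<open>Z(M)\<close> and \<open>[M,M]\<close> are such submodules.
\<close>

section \<open>Commutators and central subgroups in an arbitrary group\<close>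

lemma (in group) swap_if_square_mult:
  assumes "m \<in> carrier G" "n \<in> carrier G" "b \<in> carrier G"
    and "(m \<otimes> n) \<otimes> (m \<otimes> n) = (m \<otimes> m) \<otimes> (n \<otimes> n) \<otimes> b"
    and "b \<otimes> n = n \<otimes> b"
  shows "n \<otimes> m = m \<otimes> n \<otimes> b"
proof -
  \<comment> \<open>Moving \<open>b\<close> in front of the last \<open>n\<close> makes both sides
    of the square identity begin with \<open>m\<close> and end with \<open>n\<close>; cancelling
    these two leaves the claim.\<close>
  have "m \<otimes> (n \<otimes> m \<otimes> n) = m \<otimes> (m \<otimes> n \<otimes> b \<otimes> n)"
    using assms by (simp add: m_assoc)
  then show ?thesis
    using assms by simp
qed

lemma (in group) normal_if_central:
  assumes "subgroup H G" and "\<And>h g. \<lbrakk>h \<in> H; g \<in> carrier G\<rbrakk> \<Longrightarrow> h \<otimes> g = g \<otimes> h"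
  shows "H \<lhd> G"
  using assms by (intro normalI) (auto simp: r_coset_def l_coset_def)

text \<open>The hypothesis says that commutators lie in \<open>H\<close>. The factor
  \<open>h\<close> stands on the left because the cosets \<open>H #> x\<close> absorb on that side.
  This serves both for \<open>R\<close> modulo \<open>Im P\<close> and for \<open>M\<close> modulo
  \<open>A\<close>.\<close>

lemma (in normal) comm_group_factor:
  assumes "\<And>x y. \<lbrakk>x \<in> carrier G; y \<in> carrier G\<rbrakk> \<Longrightarrow> \<exists>h\<in>H. y \<otimes> x = h \<otimes> (x \<otimes> y)"
  shows "comm_group (G Mod H)"
proof (rule group.group_comm_groupI[OF factorgroup_is_group])
  fix U V assume "U \<in> carrier (G Mod H)" "V \<in> carrier (G Mod H)"
  then obtain x y where xy: "x \<in> carrier G" "y \<in> carrier G" "U = H #> x" "V = H #> y"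
    by (auto simp: FactGroup_def RCOSETS_def)
  obtain h where "h \<in> H" "y \<otimes> x = h \<otimes> (x \<otimes> y)"
    using assms[OF xy(1,2)] by blast
  then have "y \<otimes> x \<in> H #> (x \<otimes> y)" by (auto simp: r_coset_def)
  then have "H #> (x \<otimes> y) = H #> (y \<otimes> x)"
    using xy by (intro repr_independence subgroup_axioms) auto
  then show "U \<otimes>\<^bsub>G Mod H\<^esub> V = V \<otimes>\<^bsub>G Mod H\<^esub> U"
    using xy by (simp add: FactGroup_def rcos_sum)
qed

section \<open>The additive group of a square ring and its central subgroup
  \<open>Im P\<close>\<close>

context square_ring
begin

sublocale R: monoid R by (rule monoid_R)
sublocale E: comm_group E by (rule comm_group_E)
sublocale add: group "add_monoid R"
  rewrites "carrier (add_monoid R) = carrier R" and "mult (add_monoid R) = (\<oplus>)"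
    and "one (add_monoid R) = \<zero>"
  by (rule group_R) simp_all

abbreviation ImP where "ImP \<equiv> P ` carrier E"

lemma P_closed: "x \<in> carrier E \<Longrightarrow> P x \<in> carrier R"
  using hom_in_carrier[OF P_hom] by simp

lemma H_in: "r \<in> carrier R \<Longrightarrow> H r \<in> carrier E"
  using H_closed by auto

lemma T_closed: "x \<in> carrier E \<Longrightarrow> T x \<in> carrier E"
  by (rule hom_in_carrier[OF T_hom])

lemma P_one: "P \<one>\<^bsub>E\<^esub> = \<zero>"
  using hom_one[OF P_hom E.is_group group_R] by simp

text \<open>Both sides are \<open>(r \<oplus> s) \<otimes> (\<one> \<oplus> \<one>)\<close>,
  expanded by \<open>r_distr_R\<close> on the left and by \<open>l_distr_R\<close> on the
  right.\<close>

lemma square_add: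
  assumes r: "r \<in> carrier R" and s: "s \<in> carrier R"
  shows "(r \<oplus> s) \<oplus> (r \<oplus> s) = (r \<oplus> r) \<oplus> (s \<oplus> s) \<oplus> P (act r s (H (\<one> \<oplus> \<one>)) \<one>)"
proof -
  have "t \<otimes> (\<one> \<oplus> \<one>) = t \<oplus> t" if "t \<in> carrier R" for t
    using that by (simp add: r_distr_R)
  then show ?thesis
    using l_distr_R[OF r s, of "\<one> \<oplus> \<one>"] r s by simp
qed

lemma P_central:
  assumes x: "x \<in> carrier E" and s: "s \<in> carrier R"
  shows "P x \<oplus> s = s \<oplus> P x"
proof -
  \<comment> \<open>For \<open>r = P x\<close> the correction term in \<open>square_add\<close> is
    \<open>P\<close> of an element of the form \<open>act (P x) s y \<one>\<close>, which is neutral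
    by \<open>act_P1\<close>.\<close>
  have "s \<oplus> P x = P x \<oplus> s \<oplus> \<zero>"
    using square_add[OF P_closed[OF x] s] x s
    by (intro add.swap_if_square_mult) (simp_all add: P_closed act_P1 H_in P_one)
  then show ?thesis using x s by (simp add: P_closed)
qed

lemma add_swap:
  assumes r: "r \<in> carrier R" and s: "s \<in> carrier R"
  shows "\<exists>p\<in>ImP. s \<oplus> r = p \<oplus> (r \<oplus> s)"
proof -
  let ?x = "act r s (H (\<one> \<oplus> \<one>)) \<one>"
  have x: "?x \<in> carrier E" using r s by (simp add: act_closed H_in)
  have "s \<oplus> r = r \<oplus> s \<oplus> P ?x"
    using square_add[OF r s] r s x P_closed[OF x] P_central[OF x s]
    by (intro add.swap_if_square_mult) simp_all
  then show ?thesis using P_central[OF x, of "r \<oplus> s"] x r s by (intro bexI[of _ "P ?x"]) simp_all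
qed

lemma ImP_subgroup: "subgroup ImP (add_monoid R)"
proof -
  interpret P: group_hom E "add_monoid R" P
    by (intro group_hom.intro group_hom_axioms.intro group_R E.is_group P_hom)
  show ?thesis by (rule P.img_is_subgroup)
qed

sublocale ImP: normal ImP "add_monoid R"
  using group.normal_if_central[OF group_R ImP_subgroup] P_central by auto

section \<open>The quotient ring by \<open>Im P\<close> and the operad built on it\<close>

lemma ImP_coset_eq: "r \<in> carrier R \<Longrightarrow> x \<in> carrier E \<Longrightarrow> ImP +> (P x \<oplus> r) = ImP +> r"
  using group.repr_independence[OF group_R _ _ ImP_subgroup, of "P x \<oplus> r" r]
  by (auto simp: a_r_coset_def r_coset_def)

lemma ImP_coset_mem: "a \<in> ImP +> r \<longleftrightarrow> (\<exists>x\<in>carrier E. a = P x \<oplus> r)"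
  by (auto simp: a_r_coset_def r_coset_def)

lemma Quot_carrier: "carrier (R Quot ImP) = (\<lambda>r. ImP +> r) ` carrier R"
  by (auto simp: FactRing_def A_RCOSETS_def' a_r_coset_def' A_RCOSETS_def RCOSETS_def a_r_coset_def)

lemma Quot_one: "\<one>\<^bsub>R Quot ImP\<^esub> = ImP +> \<one>"
  by (simp add: FactRing_def)

lemma Quot_add: "r \<in> carrier R \<Longrightarrow> s \<in> carrier R
    \<Longrightarrow> (ImP +> r) \<oplus>\<^bsub>R Quot ImP\<^esub> (ImP +> s) = ImP +> (r \<oplus> s)"
  using ImP.rcos_sum[of r s] by (simp add: FactRing_def set_add_def a_r_coset_def)

text \<open>Multiplication descends to cosets although it is additive only in its right factor. The
  terms with \<open>P y\<close> and \<open>P x\<close> lie in \<open>Im P\<close> by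
  \<open>P_act\<close>, and the defect of left distributivity vanishes because its first entry is
  \<open>P x\<close>.\<close>

lemma coset_mult_P:
  assumes "r \<in> carrier R" "s \<in> carrier R" "x \<in> carrier E" "y \<in> carrier E"
  shows "ImP +> ((P x \<oplus> r) \<otimes> (P y \<oplus> s)) = ImP +> (r \<otimes> s)"
proof -
  note C = assms P_closed[OF assms(3)] P_closed[OF assms(4)]
  let ?u = "P x \<oplus> r"
  have u: "?u \<in> carrier R" using C by simp
  have "?u \<otimes> (P y \<oplus> s) = P (act ?u ?u y \<one>) \<oplus> ?u \<otimes> s"
    using C u by (simp add: r_distr_R P_act)
  then have "ImP +> (?u \<otimes> (P y \<oplus> s)) = ImP +> (?u \<otimes> s)"
    using C u by (simp add: ImP_coset_eq act_closed)
  also have "?u \<otimes> s = P (act \<one> \<one> x s) \<oplus> r \<otimes> s"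
    using C by (simp add: l_distr_R P_act act_P1 H_in P_one)
  also have "ImP +> \<dots> = ImP +> (r \<otimes> s)"
    using C by (simp add: ImP_coset_eq act_closed)
  finally show ?thesis .
qed

lemma Quot_mult:
  assumes r: "r \<in> carrier R" and s: "s \<in> carrier R"
  shows "(ImP +> r) \<otimes>\<^bsub>R Quot ImP\<^esub> (ImP +> s) = ImP +> (r \<otimes> s)"
proof -
  have "ImP +> (a \<otimes> b) = ImP +> (r \<otimes> s)" if "a \<in> ImP +> r" "b \<in> ImP +> s" for a b
    using that coset_mult_P[OF r s] by (auto simp: ImP_coset_mem)
  \<comment> \<open>The product of two cosets is defined as a union over all pairs of
    representatives. It equals the common value \<open>ImP +> (r \<otimes> s)\<close> only once the
    two index sets are known to be nonempty.\<close>
  moreover have "P \<one>\<^bsub>E\<^esub> \<oplus> t \<in> ImP +> t" for t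
    using E.one_closed ImP_coset_mem by blast
  then have "ImP +> r \<noteq> {} \<and> ImP +> s \<noteq> {}" by blast
  ultimately show ?thesis
    unfolding FactRing_def rcoset_mult_def by auto
qed

text \<open>\<open>R\<close> need not be a ring, so the axioms are checked on representatives.
  Addition becomes commutative by \<open>add_swap\<close>, and the left distributivity defect, moved
  to the front by \<open>P_central\<close>, is absorbed by the coset.\<close>

lemma Quot_ring: "ring (R Quot ImP)"
proof (rule ringI)
  have "comm_group (add_monoid R Mod ImP)"
    using add_swap by (intro ImP.comm_group_factor) simp
  moreover have "add_monoid (R Quot ImP) = add_monoid R Mod ImP"
    by (simp add: FactRing_def FactGroup_def A_RCOSETS_def set_add_def)
  ultimately show "abelian_group (R Quot ImP)"
    by (intro abelian_group.intro abelian_monoid.intro abelian_group_axioms.intro)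
      (simp_all add: comm_group_def)
  show "monoid (R Quot ImP)"
    by (rule monoidI) (auto simp: Quot_carrier Quot_mult Quot_one R.m_assoc)
next
  fix a b c
  assume "a \<in> carrier (R Quot ImP)" "b \<in> carrier (R Quot ImP)" "c \<in> carrier (R Quot ImP)"
  then obtain r s t where C: "r \<in> carrier R" "s \<in> carrier R" "t \<in> carrier R"
    and abc: "a = ImP +> r" "b = ImP +> s" "c = ImP +> t"
    by (auto simp: Quot_carrier)
  let ?x = "act r s (H t) \<one>"
  have x: "?x \<in> carrier E" using C by (simp add: act_closed H_in)
  have "(r \<oplus> s) \<otimes> t = P ?x \<oplus> (r \<otimes> t \<oplus> s \<otimes> t)"
    using C x by (simp add: l_distr_R P_central)
  then show "(a \<oplus>\<^bsub>R Quot ImP\<^esub> b) \<otimes>\<^bsub>R Quot ImP\<^esub> c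
      = a \<otimes>\<^bsub>R Quot ImP\<^esub> c \<oplus>\<^bsub>R Quot ImP\<^esub> b \<otimes>\<^bsub>R Quot ImP\<^esub> c"
    using C x by (simp add: abc Quot_add Quot_mult ImP_coset_eq)
  show "c \<otimes>\<^bsub>R Quot ImP\<^esub> (a \<oplus>\<^bsub>R Quot ImP\<^esub> b)
      = c \<otimes>\<^bsub>R Quot ImP\<^esub> a \<oplus>\<^bsub>R Quot ImP\<^esub> c \<otimes>\<^bsub>R Quot ImP\<^esub> b"
    using C by (simp add: abc Quot_add Quot_mult r_distr_R)
qed

lemma OP_simps:
  "op_unary (OP R E act T P) = R Quot ImP" "op_binary (OP R E act T P) = E"
  "op_sym (OP R E act T P) = T"
  by (simp_all add: OP_def)

text \<open>With all scalars written as cosets of representatives, \<open>OP_comp_coset\<close>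
  turns each operad axiom into the corresponding law of \<open>act\<close> or
  \<open>T\<close>.\<close>

lemma OP_nil2_operad: "nil2_operad (OP R E act T P)"
proof (unfold nil2_operad_def OP_simps, intro conjI allI impI)
qed (auto simp: Quot_ring comm_group_E T_hom T_T Quot_carrier Quot_add Quot_mult Quot_one
    OP_comp_coset T_closed act_closed act_add1 act_add2 act_add3 act_add4 act_one act_mult T_act)

end

section \<open>The center of a BHP-module\<close>

context bhp_module
begin

sublocale M: group M by (rule group_M)

abbreviation Z where "Z \<equiv> bhp_center E M brk"

lemma center_iff: "z \<in> Z \<longleftrightarrow> z \<in> carrier M \<and> (\<forall>n\<in>carrier M. \<forall>x\<in>carrier E. brk z n x = \<one>\<^bsub>M\<^esub>)"
  by (simp add: bhp_center_def)

lemma brk_center_left: "z \<in> Z \<Longrightarrow> n \<in> carrier M \<Longrightarrow> x \<in> carrier E \<Longrightarrow> brk z n x = \<one>\<^bsub>M\<^esub>"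
  by (simp add: center_iff)

text \<open>The center is defined through the left entry of the bracket; the symmetry
  \<open>brk_T\<close> transfers the vanishing to the right entry.\<close>

lemma brk_center_right: "z \<in> Z \<Longrightarrow> n \<in> carrier M \<Longrightarrow> x \<in> carrier E \<Longrightarrow> brk n z x = \<one>\<^bsub>M\<^esub>"
  using brk_T[of z n x] T_closed by (simp add: center_iff)

lemma brk_in_center:
  "\<lbrakk>m \<in> carrier M; n \<in> carrier M; x \<in> carrier E\<rbrakk> \<Longrightarrow> brk m n x \<in> Z"
  by (simp add: center_iff brk_closed brk_brk)

lemma square_mult:
  assumes m: "m \<in> carrier M" and n: "n \<in> carrier M"
  shows "(m \<otimes>\<^bsub>M\<^esub> n) \<otimes>\<^bsub>M\<^esub> (m \<otimes>\<^bsub>M\<^esub> n)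
    = (m \<otimes>\<^bsub>M\<^esub> m) \<otimes>\<^bsub>M\<^esub> (n \<otimes>\<^bsub>M\<^esub> n) \<otimes>\<^bsub>M\<^esub> brk m n (H (\<one> \<oplus> \<one>))"
proof -
  have "ract t (\<one> \<oplus> \<one>) = t \<otimes>\<^bsub>M\<^esub> t" if "t \<in> carrier M" for t
    using that by (simp add: ract_add ract_one)
  then show ?thesis
    using add_ract[OF m n, of "\<one> \<oplus> \<one>"] m n by simp
qed

lemma center_commute:
  assumes z: "z \<in> Z" and n: "n \<in> carrier M"
  shows "z \<otimes>\<^bsub>M\<^esub> n = n \<otimes>\<^bsub>M\<^esub> z"
proof -
  have zM: "z \<in> carrier M" using z by (simp add: center_iff)
  have "n \<otimes>\<^bsub>M\<^esub> z = z \<otimes>\<^bsub>M\<^esub> n \<otimes>\<^bsub>M\<^esub> \<one>\<^bsub>M\<^esub>"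
    using square_mult[OF zM n] zM n z
    by (intro M.swap_if_square_mult) (simp_all add: brk_center_left H_in)
  then show ?thesis using zM n by simp
qed

lemma mult_swap:
  assumes m: "m \<in> carrier M" and n: "n \<in> carrier M"
  shows "\<exists>x\<in>carrier E. n \<otimes>\<^bsub>M\<^esub> m = brk m n x \<otimes>\<^bsub>M\<^esub> (m \<otimes>\<^bsub>M\<^esub> n)"
proof (rule bexI)
  \<comment> \<open>This is the element measuring the failure of
    \<open>m \<mapsto> m\<cdot>2\<close> to be additive. Its bracket is central, so it can be moved
    to the front.\<close>
  let ?x = "H (\<one> \<oplus> \<one>)"
  show x: "?x \<in> carrier E" by (simp add: H_in)
  have "n \<otimes>\<^bsub>M\<^esub> m = m \<otimes>\<^bsub>M\<^esub> n \<otimes>\<^bsub>M\<^esub> brk m n ?x"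
    using square_mult[OF m n] m n x
    by (intro M.swap_if_square_mult) (simp_all add: brk_closed center_commute brk_in_center)
  then show "n \<otimes>\<^bsub>M\<^esub> m = brk m n ?x \<otimes>\<^bsub>M\<^esub> (m \<otimes>\<^bsub>M\<^esub> n)"
    using center_commute[OF brk_in_center[OF m n x], of "m \<otimes>\<^bsub>M\<^esub> n"] m n by simp
qed

lemma brk_one_left:
  assumes "n \<in> carrier M" "x \<in> carrier E"
  shows "brk \<one>\<^bsub>M\<^esub> n x = \<one>\<^bsub>M\<^esub>"
  using brk_add1[of "\<one>\<^bsub>M\<^esub>" "\<one>\<^bsub>M\<^esub>" n x] assms brk_closed[of "\<one>\<^bsub>M\<^esub>" n x]
  by (simp add: M.l_cancel_one')

lemma center_subgroup: "subgroup Z M"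
proof (rule M.subgroupI)
  show "Z \<subseteq> carrier M" by (auto simp: center_iff)
  show "Z \<noteq> {}" using brk_one_left center_iff[of "\<one>\<^bsub>M\<^esub>"] by auto
  fix a assume a: "a \<in> Z"
  then have aM: "a \<in> carrier M" by (simp add: center_iff)
  have "brk (inv\<^bsub>M\<^esub> a) n x = \<one>\<^bsub>M\<^esub>" if "n \<in> carrier M" "x \<in> carrier E" for n x
    using brk_add1[of "inv\<^bsub>M\<^esub> a" a n x] that aM
    by (simp add: brk_center_left[OF a] brk_one_left brk_closed)
  then show "inv\<^bsub>M\<^esub> a \<in> Z" using aM by (simp add: center_iff)
  fix b assume "b \<in> Z"
  then show "a \<otimes>\<^bsub>M\<^esub> b \<in> Z" using a by (simp add: center_iff brk_add1)
qed

lemma center_submodule: "bhp_submodule R E M ract brk Z"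
proof -
  have "ract z r \<in> Z" if z: "z \<in> Z" and r: "r \<in> carrier R" for z r
  proof -
    have zM: "z \<in> carrier M" using z by (simp add: center_iff)
    have "brk (ract z r) n x = \<one>\<^bsub>M\<^esub>" if "n \<in> carrier M" "x \<in> carrier E" for n x
      \<comment> \<open>With the scalars on \<open>n\<close> and on the output equal to
        \<open>\<one>\<close>, \<open>brk_ract\<close> moves \<open>r\<close> into the third
        argument: the bracket becomes \<open>brk z n (act r \<one> x \<one>)\<close>.\<close>
      using brk_ract[OF zM that(1) r R.one_closed that(2) R.one_closed] that zM r
      by (simp add: ract_one ract_closed brk_closed act_closed brk_center_left[OF z])
    then show ?thesis using zM r by (simp add: center_iff ract_closed)
  qed
  then show ?thesis
    by (auto simp: bhp_submodule_def center_subgroup intro: brk_in_center subgroup.mem_carrier[OF center_subgroup])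
qed

end

section \<open>Central submodules containing all brackets, and the operations they induce\<close>

locale central_bhp_submodule = bhp_module R E act T H P M ract brk
  for R :: "'r ring" (structure) and E :: "'e monoid" and act T H P
    and M :: "'m monoid" and ract brk +
  fixes A :: "'m set"
  assumes submodule_A: "bhp_submodule R E M ract brk A"
    and A_subset_center: "A \<subseteq> Z"
    and brk_in: "\<lbrakk>m \<in> carrier M; n \<in> carrier M; x \<in> carrier E\<rbrakk> \<Longrightarrow> brk m n x \<in> A"
begin

lemma subgroup_A: "subgroup A M"
  using submodule_A by (simp add: bhp_submodule_def)

lemma ract_in: "a \<in> A \<Longrightarrow> r \<in> carrier R \<Longrightarrow> ract a r \<in> A"
  using submodule_A by (simp add: bhp_submodule_def)

lemma A_carrier: "a \<in> A \<Longrightarrow> a \<in> carrier M"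
  by (rule subgroup.mem_carrier[OF subgroup_A])

sublocale A: normal A M
  using A_subset_center center_commute by (intro M.normal_if_central subgroup_A) blast

lemma comm_group_quotient: "comm_group (M Mod A)"
  using mult_swap brk_in by (intro A.comm_group_factor) blast

lemma coset_eq: "m \<in> carrier M \<Longrightarrow> a \<in> A \<Longrightarrow> A #>\<^bsub>M\<^esub> (a \<otimes>\<^bsub>M\<^esub> m) = A #>\<^bsub>M\<^esub> m"
  using M.repr_independence[OF _ _ subgroup_A, of "a \<otimes>\<^bsub>M\<^esub> m" m] by (auto simp: r_coset_def)

text \<open>Cosets act through arbitrarily chosen representatives; \<open>gract_1\<close> and
  \<open>gract_2\<close> show that the choice does not matter. Outside degrees 1 and 2 the value is
  the zero element.\<close>

definition gract :: "nat \<Rightarrow> 'm set \<times> 'm \<Rightarrow> 'r set \<Rightarrow> 'm set \<times> 'm" where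
  "gract k u C =
    (if k = 1 then (A #>\<^bsub>M\<^esub> ract (SOME m. m \<in> fst u) (SOME r. r \<in> C), \<one>\<^bsub>M\<^esub>)
     else if k = 2 then (A, ract (snd u) (SOME r. r \<in> C))
     else (A, \<one>\<^bsub>M\<^esub>))"

definition gbrk :: "nat \<Rightarrow> nat \<Rightarrow> 'm set \<times> 'm \<Rightarrow> 'm set \<times> 'm \<Rightarrow> 'e \<Rightarrow> 'm set \<times> 'm" where
  "gbrk i j u v x =
    (if i = 1 \<and> j = 1 then (A, brk (SOME m. m \<in> fst u) (SOME m. m \<in> fst v) x)
     else (A, \<one>\<^bsub>M\<^esub>))"

lemma some_coset_M:
  assumes "m \<in> carrier M"
  obtains a where "a \<in> A" "(SOME n. n \<in> A #>\<^bsub>M\<^esub> m) = a \<otimes>\<^bsub>M\<^esub> m"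
proof -
  have "(SOME n. n \<in> A #>\<^bsub>M\<^esub> m) \<in> A #>\<^bsub>M\<^esub> m"
    using M.rcos_self[OF assms subgroup_A] by (rule someI)
  then show thesis using that by (auto simp: r_coset_def)
qed

lemma some_coset_R:
  assumes "r \<in> carrier R"
  obtains x where "x \<in> carrier E" "(SOME s. s \<in> ImP +> r) = P x \<oplus> r"
proof -
  have "P \<one>\<^bsub>E\<^esub> \<oplus> r \<in> ImP +> r" using ImP_coset_mem by blast
  then have "(SOME s. s \<in> ImP +> r) \<in> ImP +> r" by (rule someI)
  then show thesis using that by (auto simp: ImP_coset_mem)
qed

lemma brk_A_left: "a \<in> A \<Longrightarrow> n \<in> carrier M \<Longrightarrow> x \<in> carrier E \<Longrightarrow> brk a n x = \<one>\<^bsub>M\<^esub>"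
  using A_subset_center brk_center_left by blast

lemma brk_A_right: "a \<in> A \<Longrightarrow> n \<in> carrier M \<Longrightarrow> x \<in> carrier E \<Longrightarrow> brk n a x = \<one>\<^bsub>M\<^esub>"
  using A_subset_center brk_center_right by blast

lemma ract_P_add: "\<lbrakk>m \<in> carrier M; x \<in> carrier E; r \<in> carrier R\<rbrakk>
    \<Longrightarrow> ract m (P x \<oplus> r) = brk m m x \<otimes>\<^bsub>M\<^esub> ract m r"
  by (simp add: ract_add P_closed ract_P)

text \<open>The defect of additivity is a bracket with an entry in \<open>A\<close>, hence
  trivial.\<close>

lemma ract_mult_A: "\<lbrakk>a \<in> A; m \<in> carrier M; r \<in> carrier R\<rbrakk>
    \<Longrightarrow> ract (a \<otimes>\<^bsub>M\<^esub> m) r = ract a r \<otimes>\<^bsub>M\<^esub> ract m r"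
  by (simp add: add_ract A_carrier brk_A_left H_in ract_closed)

text \<open>Another representative of the scalar changes the result by a bracket
  \<open>brk m m x\<close>, which lies in \<open>A\<close>; another representative of the coset
  changes it by \<open>ract a r\<close>, again in \<open>A\<close>.\<close>

lemma gract_1:
  assumes m: "m \<in> carrier M" and r: "r \<in> carrier R"
  shows "gract (Suc 0) (A #>\<^bsub>M\<^esub> m, e) (ImP +> r) = (A #>\<^bsub>M\<^esub> ract m r, \<one>\<^bsub>M\<^esub>)"
proof -
  obtain a where a: "a \<in> A" "(SOME n. n \<in> A #>\<^bsub>M\<^esub> m) = a \<otimes>\<^bsub>M\<^esub> m"
    by (rule some_coset_M[OF m])
  obtain x where x: "x \<in> carrier E" "(SOME s. s \<in> ImP +> r) = P x \<oplus> r"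
    by (rule some_coset_R[OF r])
  have am: "a \<otimes>\<^bsub>M\<^esub> m \<in> carrier M" using a m by (simp add: A_carrier)
  have "A #>\<^bsub>M\<^esub> ract (a \<otimes>\<^bsub>M\<^esub> m) (P x \<oplus> r) = A #>\<^bsub>M\<^esub> ract (a \<otimes>\<^bsub>M\<^esub> m) r"
    using am x r by (simp add: ract_P_add coset_eq ract_closed brk_in)
  also have "\<dots> = A #>\<^bsub>M\<^esub> ract m r"
    using a m r by (simp add: ract_mult_A coset_eq ract_closed ract_in)
  finally show ?thesis by (simp add: gract_def a x)
qed

text \<open>Here changing the scalar by \<open>P x\<close> contributes \<open>brk a a x\<close>,
  which is trivial because \<open>a\<close> is central, so the value itself is unchanged.\<close>

lemma gract_2:
  assumes a: "a \<in> A" and r: "r \<in> carrier R"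
  shows "gract (Suc (Suc 0)) (B, a) (ImP +> r) = (A, ract a r)"
proof -
  obtain x where x: "x \<in> carrier E" "(SOME s. s \<in> ImP +> r) = P x \<oplus> r"
    by (rule some_coset_R[OF r])
  have "ract a (P x \<oplus> r) = ract a r"
    using a x r by (simp add: ract_P_add A_carrier brk_A_left ract_closed)
  then show ?thesis by (simp add: gract_def x)
qed

lemma gract_other: "k \<noteq> 1 \<Longrightarrow> k \<noteq> 2 \<Longrightarrow> gract k u C = (A, \<one>\<^bsub>M\<^esub>)"
  by (simp add: gract_def)

text \<open>By biadditivity the changes of representative contribute only brackets with an entry in
  \<open>A\<close>, and these vanish.\<close>

lemma gbrk_1_1:
  assumes m: "m \<in> carrier M" and n: "n \<in> carrier M" and x: "x \<in> carrier E"
  shows "gbrk (Suc 0) (Suc 0) (A #>\<^bsub>M\<^esub> m, d) (A #>\<^bsub>M\<^esub> n, e) x = (A, brk m n x)"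
proof -
  obtain a where a: "a \<in> A" "(SOME n. n \<in> A #>\<^bsub>M\<^esub> m) = a \<otimes>\<^bsub>M\<^esub> m"
    by (rule some_coset_M[OF m])
  obtain b where b: "b \<in> A" "(SOME m. m \<in> A #>\<^bsub>M\<^esub> n) = b \<otimes>\<^bsub>M\<^esub> n"
    by (rule some_coset_M[OF n])
  show ?thesis using assms a b
    by (simp add: gbrk_def A_carrier brk_add1 brk_add2 brk_A_left brk_A_right brk_closed)
qed

lemma gbrk_other: "\<not> (i = 1 \<and> j = 1) \<Longrightarrow> gbrk i j u v x = (A, \<one>\<^bsub>M\<^esub>)"
  by (auto simp: gbrk_def)

section \<open>The graded pieces as modules and as an algebra over the operad\<close>

lemma Gr_mult: "(U, a) \<otimes>\<^bsub>Gr M A k\<^esub> (V, b) = (U <#>\<^bsub>M\<^esub> V, a \<otimes>\<^bsub>M\<^esub> b)"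
  by (simp add: Gr_def DirProd_def FactGroup_def)

lemma Gr_one: "\<one>\<^bsub>Gr M A k\<^esub> = (A, \<one>\<^bsub>M\<^esub>)"
  by (simp add: Gr_def DirProd_def FactGroup_def)

lemma Gr_carrier_1: "carrier (Gr M A (Suc 0)) = (\<lambda>m. (A #>\<^bsub>M\<^esub> m, \<one>\<^bsub>M\<^esub>)) ` carrier M"
  by (auto simp: Gr_def FactGroup_def RCOSETS_def)

lemma Gr_carrier_2: "carrier (Gr M A (Suc (Suc 0))) = (\<lambda>a. (A, a)) ` A"
  by (auto simp: Gr_def)

lemma Gr_carrier_other: "k \<noteq> 1 \<Longrightarrow> k \<noteq> 2 \<Longrightarrow> carrier (Gr M A k) = {(A, \<one>\<^bsub>M\<^esub>)}"
  by (simp add: Gr_def)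

lemma A_mult_A: "A <#>\<^bsub>M\<^esub> A = A"
  by (rule M.subgroup_mult_id[OF subgroup_A])

text \<open>The ambient product \<open>(M Mod A) \<times>\<times> M\<close> need not be abelian.
  Each piece is a product of subgroups of the two factors, at most one of them nontrivial, and that
  one is \<open>M Mod A\<close> or the central subgroup \<open>A\<close>.\<close>

lemma comm_group_Gr: "comm_group (Gr M A k)"
proof -
  interpret Q: comm_group "M Mod A" by (rule comm_group_quotient)
  interpret D: group "(M Mod A) \<times>\<times> M" by (rule DirProd_group[OF Q.is_group group_M])
  have sub: "subgroup (H \<times> K) ((M Mod A) \<times>\<times> M)"
    if "subgroup H (M Mod A)" "subgroup K M" for H K
    using that by (intro DirProd_subgroups Q.is_group group_M)
  have "subgroup (carrier (Gr M A k)) ((M Mod A) \<times>\<times> M)"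
  proof -
    have "subgroup {A} (M Mod A)" using Q.triv_subgroup by (simp add: FactGroup_def)
    then show ?thesis
      using sub[OF Q.subgroup_self M.triv_subgroup] sub[OF _ subgroup_A, of "{A}"]
        sub[OF _ M.triv_subgroup, of "{A}"]
      by (auto simp: Gr_def)
  qed
  from D.subgroup_imp_group[OF this] have g: "group (Gr M A k)"
    by (simp add: Gr_def)
  show ?thesis
  proof (rule group.group_comm_groupI[OF g])
    fix u v assume uv: "u \<in> carrier (Gr M A k)" "v \<in> carrier (Gr M A k)"
    show "u \<otimes>\<^bsub>Gr M A k\<^esub> v = v \<otimes>\<^bsub>Gr M A k\<^esub> u"
    proof (cases "k = 1")
      case True
      have "U <#>\<^bsub>M\<^esub> V = V <#>\<^bsub>M\<^esub> U" if "U \<in> carrier (M Mod A)" "V \<in> carrier (M Mod A)" for U V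
        using Q.m_comm[OF that] by (simp add: FactGroup_def)
      then show ?thesis using True uv by (auto simp: Gr_mult Gr_def)
    next
      case False
      have "a \<otimes>\<^bsub>M\<^esub> b = b \<otimes>\<^bsub>M\<^esub> a" if "a \<in> A" "b \<in> A" for a b
        using that A_subset_center A_carrier center_commute by blast
      then show ?thesis
        using False uv by (cases "k = Suc (Suc 0)") (auto simp: Gr_mult Gr_carrier_2 Gr_carrier_other)
    qed
  qed
qed

lemma right_module_Gr: "right_module (R Quot ImP) (Gr M A k) (gract k)"
proof -
  \<comment> \<open>Additivity in degree 1 holds only modulo \<open>A\<close>: the defect
    \<open>brk m n (H r)\<close> is moved to the left by centrality and then absorbed by the
    coset.\<close>
  have coset_add: "A #>\<^bsub>M\<^esub> ract (m \<otimes>\<^bsub>M\<^esub> n) r = A #>\<^bsub>M\<^esub> (ract m r \<otimes>\<^bsub>M\<^esub> ract n r)"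
    if "m \<in> carrier M" "n \<in> carrier M" "r \<in> carrier R" for m n r
    using that center_commute[OF brk_in_center[of m n "H r"], of "ract m r \<otimes>\<^bsub>M\<^esub> ract n r"]
      coset_eq[OF _ brk_in[of m n "H r"], of "ract m r \<otimes>\<^bsub>M\<^esub> ract n r"]
    by (simp add: add_ract ract_closed H_in)
  consider "k = Suc 0" | "k = Suc (Suc 0)" | "k \<noteq> 1" "k \<noteq> 2" by linarith
  then show ?thesis
  proof cases
    case 1
    show ?thesis unfolding 1
      by (intro right_module.intro Quot_ring comm_group_Gr)
        (auto simp: Gr_carrier_1 Quot_carrier Quot_add Quot_mult Quot_one gract_1 Gr_mult
          A.rcos_sum coset_add ract_closed ract_add ract_one ract_mult)
  next
    case 2
    show ?thesis unfolding 2
      by (intro right_module.intro Quot_ring comm_group_Gr)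
        (auto simp: Gr_carrier_2 Quot_carrier Quot_add Quot_mult Quot_one gract_2 Gr_mult
          A_mult_A ract_in ract_mult_A A_carrier ract_add ract_one ract_mult subgroup.m_closed[OF subgroup_A])
  next
    case 3
    then show ?thesis
      by (intro right_module.intro Quot_ring comm_group_Gr)
        (auto simp: Gr_carrier_other gract_other Gr_mult A_mult_A)
  qed
qed

lemma Gr_one_closed: "(A, \<one>\<^bsub>M\<^esub>) \<in> carrier (Gr M A k)"
  using comm_group.axioms(1)[OF comm_group_Gr[of k]] monoid.one_closed[of "Gr M A k"]
  by (simp add: Gr_one comm_monoid_def)

text \<open>In degrees (1,1) the bracket axioms reduce on representatives to the laws of
  \<open>M\<close>; in all other degrees both sides are the zero element.\<close>

lemma graded_algebra_Gr: "graded_algebra (OP R E act T P) (Gr M A) gract gbrk"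
proof (intro graded_algebra.intro OP_nil2_operad graded_algebra_axioms.intro; unfold OP_simps)
  show "right_module (R Quot ImP) (Gr M A k) (gract k)" for k
    by (rule right_module_Gr)
next
  fix i j :: nat and u v x assume ij: "1 \<le> i" "1 \<le> j"
    and u: "u \<in> carrier (Gr M A i)" and v: "v \<in> carrier (Gr M A j)" and x: "x \<in> carrier E"
  show "gbrk i j u v x \<in> carrier (Gr M A (i + j))"
    using u v x Gr_one_closed by (cases "i = Suc 0 \<and> j = Suc 0")
      (auto simp: Gr_carrier_1 Gr_carrier_2 gbrk_1_1 gbrk_other brk_in)
  show "gbrk i j (u \<otimes>\<^bsub>Gr M A i\<^esub> u') v x = gbrk i j u v x \<otimes>\<^bsub>Gr M A (i + j)\<^esub> gbrk i j u' v x"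
    if "u' \<in> carrier (Gr M A i)" for u'
    using that u v x by (cases "i = Suc 0 \<and> j = Suc 0")
      (auto simp: Gr_carrier_1 gbrk_1_1 gbrk_other Gr_mult A.rcos_sum A_mult_A brk_add1)
  show "gbrk i j u (v \<otimes>\<^bsub>Gr M A j\<^esub> v') x = gbrk i j u v x \<otimes>\<^bsub>Gr M A (i + j)\<^esub> gbrk i j u v' x"
    if "v' \<in> carrier (Gr M A j)" for v'
    using that u v x by (cases "i = Suc 0 \<and> j = Suc 0")
      (auto simp: Gr_carrier_1 gbrk_1_1 gbrk_other Gr_mult A.rcos_sum A_mult_A brk_add2)
  show "gbrk i j u v (x \<otimes>\<^bsub>E\<^esub> x') = gbrk i j u v x \<otimes>\<^bsub>Gr M A (i + j)\<^esub> gbrk i j u v x'"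
    if "x' \<in> carrier E" for x'
    using that u v x by (cases "i = Suc 0 \<and> j = Suc 0")
      (auto simp: Gr_carrier_1 gbrk_1_1 gbrk_other Gr_mult A_mult_A brk_add3)
  show "gbrk j i v u x = gbrk i j u v (T x)"
    using u v x T_closed[OF x] by (cases "i = Suc 0 \<and> j = Suc 0")
      (auto simp: Gr_carrier_1 gbrk_1_1 gbrk_other brk_T)
  \<comment> \<open>Unless \<open>i = j = 1\<close>, positivity of the degrees gives
    \<open>i + j \<ge> 3\<close>, where \<open>gract\<close> is zero. In degrees (1,1) the output
    has degree 2 and \<open>gract_2\<close> applies to the bracket.\<close>
  show "gract (i + j) (gbrk i j (gract i u r) (gract j v s) x) t
      = gbrk i j u v (op_comp (OP R E act T P) r s x t)"
    if "r \<in> carrier (R Quot ImP)" "s \<in> carrier (R Quot ImP)" "t \<in> carrier (R Quot ImP)" for r s t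
    using that ij u v x by (cases "i = Suc 0 \<and> j = Suc 0")
      (auto simp: Gr_carrier_1 Quot_carrier gbrk_1_1 gbrk_other gract_1 gract_2 gract_other
        OP_comp_coset ract_closed act_closed brk_in brk_ract)
  \<comment> \<open>As \<open>i + j \<ge> 2\<close>, the outer bracket is never in degrees
    (1,1).\<close>
  show "gbrk (i + j) k (gbrk i j u v x) w y = \<one>\<^bsub>Gr M A (i + j + k)\<^esub>" for k w y
    using ij by (simp add: gbrk_other Gr_one)
qed

lemma graded_structure:
  "\<exists>gract gbrk. graded_algebra (OP R E act T P) (Gr M A) gract gbrk \<and>
    induced_operations R E P M ract brk A gract gbrk"
proof (intro exI conjI)
  show "induced_operations R E P M ract brk A gract gbrk"
    by (simp add: induced_operations_def numeral_2_eq_2 gract_1 gract_2 gbrk_1_1)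
qed (rule graded_algebra_Gr)

end

section \<open>The submodule generated by the brackets, and the conclusion\<close>

context bhp_module
begin

lemma brk_in_derived:
  "\<lbrakk>m \<in> carrier M; n \<in> carrier M; x \<in> carrier E\<rbrakk> \<Longrightarrow> brk m n x \<in> bhp_derived R E M ract brk"
  by (auto simp: bhp_derived_def bhp_generate_def)

text \<open>\<open>Z\<close> is itself one of the submodules whose intersection defines
  \<open>bhp_derived\<close>.\<close>

lemma derived_subset_center: "bhp_derived R E M ract brk \<subseteq> Z"
  using center_submodule brk_in_center unfolding bhp_derived_def bhp_generate_def
  by (intro Inter_lower) auto

lemma derived_submodule: "bhp_submodule R E M ract brk (bhp_derived R E M ract brk)"
proof -
  let ?F = "{N. bhp_submodule R E M ract brk N \<and>
    {brk m n x | m n x. m \<in> carrier M \<and> n \<in> carrier M \<and> x \<in> carrier E} \<subseteq> N}"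
  \<comment> \<open>The intersection is a subgroup only because the family is nonempty;
    \<open>Z\<close> is the witness.\<close>
  have "Z \<in> ?F" using center_submodule brk_in_center by auto
  then have "subgroup (\<Inter>?F) M"
    by (intro M.subgroups_Inter) (auto simp: bhp_submodule_def)
  then show ?thesis
    by (auto simp: bhp_derived_def bhp_generate_def bhp_submodule_def)
qed

end

theorem proposition2p2p20:
  fixes R :: "'r ring" and E :: "'e monoid" and M :: "'m monoid"
  assumes "square_ring R E act T H P"
    and "bhp_module R E act T H P M ract brk"
  shows "(\<exists>gract gbrk.
        graded_algebra (OP R E act T P) (Gr M (bhp_derived R E M ract brk)) gract gbrk \<and>
        induced_operations R E P M ract brk (bhp_derived R E M ract brk) gract gbrk) \<and>
      (\<exists>gract gbrk.
        graded_algebra (OP R E act T P) (Gr M (bhp_center E M brk)) gract gbrk \<and>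
        induced_operations R E P M ract brk (bhp_center E M brk) gract gbrk)"
proof -
  interpret bhp_module R E act T H P M ract brk by (rule assms(2))
  \<comment> \<open>The two extreme choices of \<open>A\<close> are used: the smallest submodule
    containing all brackets, and then the whole center.\<close>
  interpret D: central_bhp_submodule R E act T H P M ract brk "bhp_derived R E M ract brk"
    using derived_submodule derived_subset_center brk_in_derived by unfold_locales
  interpret Z: central_bhp_submodule R E act T H P M ract brk "bhp_center E M brk"
    using center_submodule brk_in_center by unfold_locales auto
  show ?thesis using D.graded_structure Z.graded_structure by blast
qed

end
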